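(* Let $T_1,T_2:V\to\mathfrak g$ be two $\mathcal O$-operators on a pre-Lie algebra $(\mathfrak g,\cdot_{\mathfrak g})$ associated to a representation $(V;\rho,\mu)$. Suppose that $T_1$ and $T_2$ are invertible. Then $T_1$ and $T_2$ are compatible if and only if $N=T_1\circ T_2^{-1}$ is a Nijenhuis operator on $(\mathfrak g,\cdot_{\mathfrak g})$.
   Context: $\mathbb K$ is an algebraically closed field of characteristic $0$; vector spaces are finite dimensional over $\mathbb K$. A pre-Lie algebra is a vector space $\mathfrak g$ with a bilinear product $\cdot_{\mathfrak g}$ such that $(x\cdot_{\mathfrak g} y)\cdot_{\mathfrak g} z-x\cdot_{\mathfrak g}(y\cdot_{\mathfrak g} z)$ is symmetric in $x,y$; $[x,y]^c=x\cdot_{\mathfrak g}y-y\cdot_{\mathfrak g}x$ is then a Lie bracket. A representation $(V;\rho,\mu)$ consists of a vector space $V$, a representation $\rho:\mathfrak g\to\mathfrak{gl}(V)$ of the Lie algebra $(\mathfrak g,[\cdot,\cdot]^c)$ and a linear map $\mu:\mathfrak g\to\mathfrak{gl}(V)$ with $\rho(x)\mu(y)-\mu(y)\rho(x)=\mu(x\cdot_{\mathfrak g}y)-\mu(y)\mu(x)$ for all $x,y\in\mathfrak g$. A linear map $T:V\to\mathfrak g$ is an $\mathcal O$-operator associated to $(V;\rho,\mu)$ if $T(u)\cdot_{\mathfrak g}T(v)=T\big(\rho(T(u))(v)+\mu(T(v))(u)\big)$ for all $u,v\in V$. Two $\mathcal O$-operators $T_1,T_2$ associated to $(V;\rho,\mu)$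 are compatible if $k_1T_1+k_2T_2$ is an $\mathcal O$-operator associated to $(V;\rho,\mu)$ for all $k_1,k_2\in\mathbb K$. A linear map $N:\mathfrak g\to\mathfrak g$ is a Nijenhuis operator if $N(x)\cdot_{\mathfrak g}N(y)=N\big(N(x)\cdot_{\mathfrak g}y+x\cdot_{\mathfrak g}N(y)-N(x\cdot_{\mathfrak g}y)\big)$ for all $x,y$. *)

theory Defs
  imports Main "HOL-Computational_Algebra.Polynomial"
begin

definition bilinear_map ::
    "('k::field \<Rightarrow> 'a::ab_group_add \<Rightarrow> 'a) \<Rightarrow> ('k \<Rightarrow> 'b::ab_group_add \<Rightarrow> 'b) \<Rightarrow>
     ('k \<Rightarrow> 'c::ab_group_add \<Rightarrow> 'c) \<Rightarrow> ('a \<Rightarrow> 'b \<Rightarrow> 'c) \<Rightarrow> bool" where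
  "bilinear_map sA sB sC f \<longleftrightarrow>
     (\<forall>x. Vector_Spaces.linear sB sC (f x)) \<and>
     (\<forall>y. Vector_Spaces.linear sA sC (\<lambda>x. f x y))"

definition commutator :: "('a::ab_group_add \<Rightarrow> 'a \<Rightarrow> 'a) \<Rightarrow> 'a \<Rightarrow> 'a \<Rightarrow> 'a" where
  "commutator m x y = m x y - m y x"

locale lie_algebra = vector_space scale
  for scale :: "'k::field \<Rightarrow> 'g::ab_group_add \<Rightarrow> 'g" +
  fixes bracket :: "'g \<Rightarrow> 'g \<Rightarrow> 'g"
  assumes bracket_bilinear: "bilinear_map scale scale scale bracket"
    and bracket_self: "bracket x x = 0"
    and jacobi: "bracket x (bracket y z) + bracket y (bracket z x) + bracket z (bracket x y) = 0"

(* A linear map from g to gl(V) is encoded in curried form, as a bilinear map from g and V to V. *)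
locale lie_representation =
  lie_algebra scaleg bracket + V: vector_space scaleV
  for scaleg :: "'k::field \<Rightarrow> 'g::ab_group_add \<Rightarrow> 'g"
    and bracket :: "'g \<Rightarrow> 'g \<Rightarrow> 'g"
    and scaleV :: "'k \<Rightarrow> 'v::ab_group_add \<Rightarrow> 'v" +
  fixes \<rho> :: "'g \<Rightarrow> 'v \<Rightarrow> 'v"
  assumes rho_bilinear: "bilinear_map scaleg scaleV scaleV \<rho>"
    and rho_bracket: "\<rho> (bracket x y) v = \<rho> x (\<rho> y v) - \<rho> y (\<rho> x v)"

locale pre_lie_algebra = vector_space scale
  for scale :: "'k::field \<Rightarrow> 'g::ab_group_add \<Rightarrow> 'g" +
  fixes mul :: "'g \<Rightarrow> 'g \<Rightarrow> 'g"
  assumes mul_bilinear: "bilinear_map scale scale scale mul"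
    and associator_sym:
      "mul (mul x y) z - mul x (mul y z) = mul (mul y x) z - mul y (mul x z)"
begin

lemma commutator_lie_algebra: "lie_algebra scale (commutator mul)"
proof -
  have L: "module_hom scale scale (mul x)" "module_hom scale scale (\<lambda>x. mul x y)" for x y
    using mul_bilinear by (auto simp: bilinear_map_def Vector_Spaces.linear_def)
  note simps = L[THEN module_hom.add] L[THEN module_hom.scale] L[THEN module_hom.diff]
  have lin: "Vector_Spaces.linear scale scale (commutator mul x)"
    "Vector_Spaces.linear scale scale (\<lambda>x. commutator mul x y)" for x y
    by (unfold_locales; simp add: commutator_def simps scale_right_diff_distrib algebra_simps)+
  let ?a = "\<lambda>x y z. mul (mul x y) z - mul x (mul y z)"
  have jac: "commutator mul x (commutator mul y z) + commutator mul y (commutator mul z x)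
      + commutator mul z (commutator mul x y) = 0" (is "?J = 0") for x y z
  proof -
    have "?J = (?a y x z - ?a x y z) + (?a z y x - ?a y z x) + (?a x z y - ?a z x y)"
      by (simp add: commutator_def simps algebra_simps)
    also have "\<dots> = 0"
      using associator_sym[of x y z] associator_sym[of y z x] associator_sym[of z x y] by simp
    finally show ?thesis .
  qed
  show ?thesis
    by unfold_locales (auto simp: bilinear_map_def lin jac, simp add: commutator_def)
qed

end

locale pre_lie_representation =
  pre_lie_algebra scaleg mul + lie_representation scaleg "commutator mul" scaleV \<rho>
  for scaleg :: "'k::field \<Rightarrow> 'g::ab_group_add \<Rightarrow> 'g"
    and mul :: "'g \<Rightarrow> 'g \<Rightarrow> 'g"
    and scaleV :: "'k \<Rightarrow> 'v::ab_group_add \<Rightarrow> 'v"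
    and \<rho> :: "'g \<Rightarrow> 'v \<Rightarrow> 'v" +
  fixes \<mu> :: "'g \<Rightarrow> 'v \<Rightarrow> 'v"
  assumes mu_bilinear: "bilinear_map scaleg scaleV scaleV \<mu>"
    and rho_mu: "\<rho> x (\<mu> y v) - \<mu> y (\<rho> x v) = \<mu> (mul x y) v - \<mu> y (\<mu> x v)"

definition O_operator ::
    "('k::field \<Rightarrow> 'g::ab_group_add \<Rightarrow> 'g) \<Rightarrow> ('g \<Rightarrow> 'g \<Rightarrow> 'g) \<Rightarrow>
     ('k \<Rightarrow> 'v::ab_group_add \<Rightarrow> 'v) \<Rightarrow> ('g \<Rightarrow> 'v \<Rightarrow> 'v) \<Rightarrow> ('g \<Rightarrow> 'v \<Rightarrow> 'v) \<Rightarrow>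
     ('v \<Rightarrow> 'g) \<Rightarrow> bool" where
  "O_operator scaleg mul scaleV \<rho> \<mu> T \<longleftrightarrow>
     Vector_Spaces.linear scaleV scaleg T \<and>
     (\<forall>u v. mul (T u) (T v) = T (\<rho> (T u) v + \<mu> (T v) u))"

definition compatible_O_operators ::
    "('k::field \<Rightarrow> 'g::ab_group_add \<Rightarrow> 'g) \<Rightarrow> ('g \<Rightarrow> 'g \<Rightarrow> 'g) \<Rightarrow>
     ('k \<Rightarrow> 'v::ab_group_add \<Rightarrow> 'v) \<Rightarrow> ('g \<Rightarrow> 'v \<Rightarrow> 'v) \<Rightarrow> ('g \<Rightarrow> 'v \<Rightarrow> 'v) \<Rightarrow>
     ('v \<Rightarrow> 'g) \<Rightarrow> ('v \<Rightarrow> 'g) \<Rightarrow> bool" where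
  "compatible_O_operators scaleg mul scaleV \<rho> \<mu> T1 T2 \<longleftrightarrow>
     (\<forall>k1 k2. O_operator scaleg mul scaleV \<rho> \<mu> (\<lambda>u. scaleg k1 (T1 u) + scaleg k2 (T2 u)))"

definition Nijenhuis_operator ::
    "('k::field \<Rightarrow> 'g::ab_group_add \<Rightarrow> 'g) \<Rightarrow> ('g \<Rightarrow> 'g \<Rightarrow> 'g) \<Rightarrow> ('g \<Rightarrow> 'g) \<Rightarrow> bool" where
  "Nijenhuis_operator scaleg mul N \<longleftrightarrow>
     Vector_Spaces.linear scaleg scaleg N \<and>
     (\<forall>x y. mul (N x) (N y) = N (mul (N x) y + mul x (N y) - N (mul x y)))"

end

theory Submission
  imports Defs
begin

text \<open>
  Write \<open>A\<^sub>i(u,v) = \<rho>(T\<^sub>i u) v + \<mu>(T\<^sub>i v) u\<close>, so that the hypothesis on \<open>T\<^sub>i\<close> reads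
  \<open>T\<^sub>i u \<cdot> T\<^sub>i v = T\<^sub>i A\<^sub>i(u,v)\<close>. The defect \<open>T u \<cdot> T v - T (\<rho>(T u) v + \<mu>(T v) u)\<close> is quadratic
  in \<open>T\<close>; on \<open>k\<^sub>1 T\<^sub>1 + k\<^sub>2 T\<^sub>2\<close> the two pure square terms vanish and what remains is \<open>k\<^sub>1 k\<^sub>2\<close> times
  the polar form of the defect at \<open>(T\<^sub>1, T\<^sub>2)\<close>. Hence compatibility is the single identity
  \<open>T\<^sub>1 u \<cdot> T\<^sub>2 v + T\<^sub>2 u \<cdot> T\<^sub>1 v = T\<^sub>1 A\<^sub>2(u,v) + T\<^sub>2 A\<^sub>1(u,v)\<close>
  (\<open>compatible_iff_mixed_identity\<close>).

  On the other side, as \<open>T\<^sub>2\<close> is onto, the Nijenhuis condition for \<open>N = T\<^sub>1 T\<^sub>2\<^sup>-\<^sup>1\<close> may be tested on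
  \<open>x = T\<^sub>2 u\<close>, \<open>y = T\<^sub>2 v\<close>. Then \<open>N x = T\<^sub>1 u\<close>, \<open>N y = T\<^sub>1 v\<close>, and \<open>N (x \<cdot> y) = T\<^sub>1 A\<^sub>2(u,v)\<close>
  while \<open>N x \<cdot> N y = T\<^sub>1 A\<^sub>1(u,v) = N (T\<^sub>2 A\<^sub>1(u,v))\<close>. Cancelling the injective map \<open>N\<close> leaves
  the same identity (\<open>Nijenhuis_iff_mixed_identity\<close>).
\<close>

lemma linear_inv:
  assumes "Vector_Spaces.linear sA sB f" and "bij f"
  shows "Vector_Spaces.linear sB sA (inv f)"
proof -
  interpret f: Vector_Spaces.linear sA sB f by fact
  have f_inv: "f (inv f x) = x" for x
    using \<open>bij f\<close> by (simp add: bij_is_surj surj_f_inv_f)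
  have inv_eqI: "inv f y = x" if "f x = y" for x y
    using that \<open>bij f\<close> by (metis bij_inv_eq_iff)
  show ?thesis
    by unfold_locales (rule inv_eqI; simp add: f.add f.scale f_inv)+
qed

lemma bilinear_map_expand:
  assumes "bilinear_map sA sB sC f"
  shows "f (x + x') y = f x y + f x' y" and "f (sA k x) y = sC k (f x y)"
    and "f x (y + y') = f x y + f x y'" and "f x (sB k y) = sC k (f x y)"
  using assms by (auto simp: bilinear_map_def Vector_Spaces.linear_iff)

context pre_lie_representation
begin

text \<open>The polar form of the quadratic defect of the \<open>\<O>\<close>-operator equation, set equal to zero.\<close>

definition mixed_identity :: "('v \<Rightarrow> 'g) \<Rightarrow> ('v \<Rightarrow> 'g) \<Rightarrow> bool" where
  "mixed_identity T1 T2 \<longleftrightarrow>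
     (\<forall>u v. mul (T1 u) (T2 v) + mul (T2 u) (T1 v) =
        T1 (\<rho> (T2 u) v + \<mu> (T2 v) u) + T2 (\<rho> (T1 u) v + \<mu> (T1 v) u))"

text \<open>
  Expand bilinearly: the coefficients of \<open>k1\<^sup>2\<close> and \<open>k2\<^sup>2\<close> are the defects of \<open>T1\<close> and \<open>T2\<close>,
  which are zero, so only the cross terms survive.
\<close>

lemma linear_combination_defect:
  assumes O1: "O_operator scaleg mul scaleV \<rho> \<mu> T1"
    and O2: "O_operator scaleg mul scaleV \<rho> \<mu> T2"
    and T: "T = (\<lambda>u. scaleg k1 (T1 u) + scaleg k2 (T2 u))"
  shows "mul (T u) (T v) - T (\<rho> (T u) v + \<mu> (T v) u) =
    scaleg (k1 * k2) (mul (T1 u) (T2 v) + mul (T2 u) (T1 v)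
      - (T1 (\<rho> (T2 u) v + \<mu> (T2 v) u) + T2 (\<rho> (T1 u) v + \<mu> (T1 v) u)))"
proof -
  have lin: "Ti (a + b) = Ti a + Ti b" "Ti (scaleV k a) = scaleg k (Ti a)"
    if "Ti \<in> {T1, T2}" for Ti a b k
    using O1 O2 that by (auto simp: O_operator_def Vector_Spaces.linear_iff)
  have pure: "mul (Ti u) (Ti v) = Ti (\<rho> (Ti u) v) + Ti (\<mu> (Ti v) u)" if "Ti \<in> {T1, T2}" for Ti
    using O1 O2 that lin[OF that] by (auto simp: O_operator_def)
  show ?thesis
    unfolding T
    by (simp add: lin pure bilinear_map_expand[OF mul_bilinear] bilinear_map_expand[OF rho_bilinear]
        bilinear_map_expand[OF mu_bilinear] scale_right_distrib scale_right_diff_distrib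
        algebra_simps)
qed

lemma compatible_iff_mixed_identity:
  assumes O1: "O_operator scaleg mul scaleV \<rho> \<mu> T1"
    and O2: "O_operator scaleg mul scaleV \<rho> \<mu> T2"
  shows "compatible_O_operators scaleg mul scaleV \<rho> \<mu> T1 T2 \<longleftrightarrow> mixed_identity T1 T2"
proof
  assume "compatible_O_operators scaleg mul scaleV \<rho> \<mu> T1 T2"
  \<comment> \<open>The coefficients \<open>k\<^sub>1 = k\<^sub>2 = 1\<close> already isolate the polar form.\<close>
  then have "O_operator scaleg mul scaleV \<rho> \<mu> (\<lambda>u. scaleg 1 (T1 u) + scaleg 1 (T2 u))"
    unfolding compatible_O_operators_def by blast
  then show "mixed_identity T1 T2"
    using linear_combination_defect[OF O1 O2 refl, where ?k1.0 = 1 and ?k2.0 = 1]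
    by (simp add: O_operator_def mixed_identity_def)
next
  assume mixed: "mixed_identity T1 T2"
  show "compatible_O_operators scaleg mul scaleV \<rho> \<mu> T1 T2"
    unfolding compatible_O_operators_def
  proof (intro allI)
    fix k1 k2
    let ?T = "\<lambda>u. scaleg k1 (T1 u) + scaleg k2 (T2 u)"
    have "Vector_Spaces.linear scaleV scaleg ?T"
      using O1 O2 by (auto simp: O_operator_def Vector_Spaces.linear_iff algebra_simps
          scale_right_distrib)
    moreover have "mul (?T u) (?T v) - ?T (\<rho> (?T u) v + \<mu> (?T v) u) = 0" for u v
      using mixed linear_combination_defect[OF O1 O2 refl, where ?k1.0 = k1 and ?k2.0 = k2]
      by (simp add: mixed_identity_def)
    ultimately show "O_operator scaleg mul scaleV \<rho> \<mu> ?T"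
      by (simp add: O_operator_def)
  qed
qed

text \<open>
  Over the base points \<open>T2 u\<close> and \<open>T2 v\<close> the whole Nijenhuis identity is the image under \<open>N\<close> of the mixed
  identity; injectivity of \<open>T1\<close> is what allows \<open>N\<close> to be cancelled.
\<close>

lemma Nijenhuis_iff_mixed_identity:
  assumes O1: "O_operator scaleg mul scaleV \<rho> \<mu> T1"
    and O2: "O_operator scaleg mul scaleV \<rho> \<mu> T2"
    and "inj T1" and "bij T2"
  shows "Nijenhuis_operator scaleg mul (T1 \<circ> inv T2) \<longleftrightarrow> mixed_identity T1 T2"
proof -
  define N where "N = T1 \<circ> inv T2"
  have N_T2: "N (T2 u) = T1 u" for u
    using \<open>bij T2\<close> by (simp add: N_def bij_is_inj)
  have lin: "Vector_Spaces.linear scaleg scaleg N"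
    unfolding N_def using O1 O2 \<open>bij T2\<close>
    by (auto simp: O_operator_def intro: Vector_Spaces.linear_compose linear_inv)
  have "inj N"
    unfolding N_def using \<open>inj T1\<close> \<open>bij T2\<close> by (simp add: inj_compose bij_is_inj bij_imp_bij_inv)
  let ?A1 = "\<lambda>u v. \<rho> (T1 u) v + \<mu> (T1 v) u"
  let ?A2 = "\<lambda>u v. \<rho> (T2 u) v + \<mu> (T2 v) u"
  have surj_all: "(\<forall>x. P x) \<longleftrightarrow> (\<forall>u. P (T2 u))" for P
    using \<open>bij T2\<close> by (metis bij_pointE)
  have "Nijenhuis_operator scaleg mul N \<longleftrightarrow>
      (\<forall>u v. mul (T1 u) (T1 v) =
        N (mul (T1 u) (T2 v) + mul (T2 u) (T1 v) - N (mul (T2 u) (T2 v))))"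
    unfolding Nijenhuis_operator_def surj_all by (simp add: lin N_T2)
  also have "\<dots> \<longleftrightarrow> (\<forall>u v. N (T2 (?A1 u v)) =
        N (mul (T1 u) (T2 v) + mul (T2 u) (T1 v) - T1 (?A2 u v)))"
    using O1 O2 by (simp add: O_operator_def N_T2)
  also have "\<dots> \<longleftrightarrow> mixed_identity T1 T2"
    unfolding inj_eq[OF \<open>inj N\<close>] mixed_identity_def
    by (simp add: eq_diff_eq add.commute) metis
  finally show ?thesis
    unfolding N_def .
qed

end

theorem corollary5p12:
  fixes scaleg :: "'k::{alg_closed_field, field_char_0} \<Rightarrow> 'g::ab_group_add \<Rightarrow> 'g"
    and scaleV :: "'k \<Rightarrow> 'v::ab_group_add \<Rightarrow> 'v"
    and Bg :: "'g set" and BV :: "'v set"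
    and mul :: "'g \<Rightarrow> 'g \<Rightarrow> 'g"
    and \<rho> \<mu> :: "'g \<Rightarrow> 'v \<Rightarrow> 'v"
    and T1 T2 :: "'v \<Rightarrow> 'g"
  assumes "finite_dimensional_vector_space scaleg Bg"
    and "finite_dimensional_vector_space scaleV BV"
    and "pre_lie_algebra scaleg mul"
    and "pre_lie_representation scaleg mul scaleV \<rho> \<mu>"
    and "O_operator scaleg mul scaleV \<rho> \<mu> T1"
    and "O_operator scaleg mul scaleV \<rho> \<mu> T2"
    and "bij T1" and "bij T2"
  shows "compatible_O_operators scaleg mul scaleV \<rho> \<mu> T1 T2 \<longleftrightarrow>
         Nijenhuis_operator scaleg mul (T1 \<circ> inv T2)"
proof -
  interpret pre_lie_representation scaleg mul scaleV \<rho> \<mu> by fact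
  show ?thesis
    using assms compatible_iff_mixed_identity Nijenhuis_iff_mixed_identity
    by (simp add: bij_is_inj)
qed

end
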